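(* Let $R$ be a unique factorization domain that is not a field. Then $R$ is a principal ideal domain if and only if for every irreducible element $p\in R$ it holds that $\langle p\rangle=\mathrm{cl}_{\widetilde{M(R)}}(\{p\})=R\setminus\sigma_p$.
   Context: $\langle r\rangle$ is the ideal of $R$ generated by $r$. For $r\in R$ let $\sigma_r=\{s\in R:\langle r\rangle+\langle s\rangle=R\}$. $\widetilde{M(R)}$ is the set $R$ with the topology having the basis $\{\sigma_r: r\in R\}$. $\mathrm{cl}_Y(A)$ denotes the closure of $A$ in the topological space $Y$. *)

theory Defs
  imports "HOL-Analysis.Abstract_Topology" "HOL-Algebra.Ring_Divisibility"
begin

definition comax_set :: "('a, 'b) ring_scheme \<Rightarrow> 'a \<Rightarrow> 'a set"
  where "comax_set R r = {s \<in> carrier R. Idl\<^bsub>R\<^esub> {r} <+>\<^bsub>R\<^esub> Idl\<^bsub>R\<^esub> {s} = carrier R}"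

text \<open>
  The constant \<^const>\<open>topology\<close> is meaningful only for families satisfying
  \<^const>\<open>istopology\<close>; \<open>istopology_comax\<close> below shows that this is the case here.
\<close>
definition comax_topology :: "('a, 'b) ring_scheme \<Rightarrow> 'a topology"
  where "comax_topology R = topology (arbitrary union_of (\<lambda>U. \<exists>r\<in>carrier R. U = comax_set R r))"

context cring
begin

lemma mem_comax_set_iff:
  assumes r: "r \<in> carrier R" and s: "s \<in> carrier R"
  shows "s \<in> comax_set R r \<longleftrightarrow> (\<exists>a\<in>carrier R. \<exists>b\<in>carrier R. a \<otimes> r \<oplus> b \<otimes> s = \<one>)"
proof -
  have I: "ideal (PIdl r <+>\<^bsub>R\<^esub> PIdl s) R"
    using r s by (intro add_ideals cgenideal_ideal)
  have "s \<in> comax_set R r \<longleftrightarrow> PIdl r <+>\<^bsub>R\<^esub> PIdl s = carrier R"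
    using r s by (simp add: comax_set_def cgenideal_eq_genideal)
  also have "\<dots> \<longleftrightarrow> \<one> \<in> PIdl r <+>\<^bsub>R\<^esub> PIdl s"
    using ideal.one_imp_carrier[OF I] by auto
  also have "\<dots> \<longleftrightarrow> (\<exists>a\<in>carrier R. \<exists>b\<in>carrier R. a \<otimes> r \<oplus> b \<otimes> s = \<one>)"
    unfolding set_add_def' cgenideal_def by (rule iffI; clarsimp; metis)
  finally show ?thesis .
qed

lemma comax_set_Int:
  assumes r: "r \<in> carrier R" and s: "s \<in> carrier R"
  shows "comax_set R r \<inter> comax_set R s = comax_set R (r \<otimes> s)"
proof (intro equalityI subsetI)
  fix t assume t: "t \<in> comax_set R r \<inter> comax_set R s"
  then have tc: "t \<in> carrier R" by (simp add: comax_set_def)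
  obtain a b where ab: "a \<in> carrier R" "b \<in> carrier R" "a \<otimes> r \<oplus> b \<otimes> t = \<one>"
    using t r tc mem_comax_set_iff by blast
  obtain c d where cd: "c \<in> carrier R" "d \<in> carrier R" "c \<otimes> s \<oplus> d \<otimes> t = \<one>"
    using t s tc mem_comax_set_iff by blast
  have "(a \<otimes> c) \<otimes> (r \<otimes> s) \<oplus> (a \<otimes> r \<otimes> d \<oplus> b \<otimes> (c \<otimes> s \<oplus> d \<otimes> t)) \<otimes> t
      = (a \<otimes> r \<oplus> b \<otimes> t) \<otimes> (c \<otimes> s \<oplus> d \<otimes> t)"
    using ab(1,2) cd(1,2) r s tc by algebra
  also have "\<dots> = \<one>" using ab cd by simp
  finally show "t \<in> comax_set R (r \<otimes> s)"
    using ab(1,2) cd(1,2) r s tc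
    by (intro mem_comax_set_iff[THEN iffD2] bexI[where x = "a \<otimes> c"]
        bexI[where x = "a \<otimes> r \<otimes> d \<oplus> b \<otimes> (c \<otimes> s \<oplus> d \<otimes> t)"])
      (assumption | intro add.m_closed m_closed)+
next
  fix t assume t: "t \<in> comax_set R (r \<otimes> s)"
  then have tc: "t \<in> carrier R" by (simp add: comax_set_def)
  obtain a b where ab: "a \<in> carrier R" "b \<in> carrier R" "a \<otimes> (r \<otimes> s) \<oplus> b \<otimes> t = \<one>"
    using t r s tc mem_comax_set_iff[of "r \<otimes> s" t] by blast
  have "(a \<otimes> s) \<otimes> r \<oplus> b \<otimes> t = \<one>" "(a \<otimes> r) \<otimes> s \<oplus> b \<otimes> t = \<one>"
    using ab r s tc by (simp_all add: m_ac)
  then show "t \<in> comax_set R r \<inter> comax_set R s"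
    using ab(1,2) r s tc by (auto simp: mem_comax_set_iff)
qed

lemma istopology_comax: "istopology (arbitrary union_of (\<lambda>U. \<exists>r\<in>carrier R. U = comax_set R r))"
  by (rule istopology_base) (use comax_set_Int in blast)

lemma openin_comax_topology:
  "openin (comax_topology R) = arbitrary union_of (\<lambda>U. \<exists>r\<in>carrier R. U = comax_set R r)"
  by (simp add: comax_topology_def istopology_comax)

lemma topspace_comax_topology: "topspace (comax_topology R) = carrier R"
proof
  show "topspace (comax_topology R) \<subseteq> carrier R"
    by (auto simp: topspace_def openin_comax_topology union_of_def comax_set_def)
  have "comax_set R \<one> = carrier R"
  proof (intro equalityI subsetI)
    fix s assume s: "s \<in> carrier R"
    then have "\<one> \<otimes> \<one> \<oplus> \<zero> \<otimes> s = \<one>" by simp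
    then show "s \<in> comax_set R \<one>"
      using s mem_comax_set_iff[of \<one> s] by blast
  qed (simp add: comax_set_def)
  then have "openin (comax_topology R) (carrier R)"
    unfolding openin_comax_topology by (intro arbitrary_union_of_inc) auto
  then show "carrier R \<subseteq> topspace (comax_topology R)"
    by (rule openin_subset)
qed

end

end

theory Submission
  imports Defs
begin

text \<open>
  For a nonunit \<open>p\<close>, the inclusions \<open>\<langle>p\<rangle> \<subseteq> cl {p} \<subseteq> R - \<sigma>\<^sub>p\<close> hold in every commutative ring: an
  element comaximal with a multiple of \<open>p\<close> is comaximal with \<open>p\<close>, and \<open>\<sigma>\<^sub>p\<close> is an open set that
  misses \<open>p\<close>. Hence, for such \<open>p\<close>, equality throughout says just \<open>\<langle>p\<rangle> = R - \<sigma>\<^sub>p\<close>: every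
  element outside \<open>\<langle>p\<rangle>\<close> generates the unit ideal together with \<open>p\<close>. This is maximality of
  \<open>\<langle>p\<rangle>\<close> (\<open>maximalideal_cgenideal_iff\<close>). So the topology drops out, and what remains is that a
  factorial domain is a principal ideal domain if and only if every irreducible element generates
  a maximal ideal.

  In a principal ideal domain, irreducible elements generate maximal ideals. For the converse, a
  nonzero ideal \<open>I\<close> contains a product \<open>p\<^sub>1 \<dots> p\<^sub>n\<close> of irreducibles, and its principality follows by
  induction on \<open>n\<close>. If \<open>I \<subseteq> \<langle>p\<^sub>1\<rangle>\<close>, then \<open>I = p\<^sub>1 J\<close> where \<open>J\<close> contains \<open>p\<^sub>2 \<dots> p\<^sub>n\<close>, and a generator
  of \<open>J\<close> times \<open>p\<^sub>1\<close> generates \<open>I\<close>. Otherwise maximality gives \<open>1 \<in> \<langle>p\<^sub>1\<rangle> + I\<close>, and multiplying by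
  \<open>p\<^sub>2 \<dots> p\<^sub>n\<close> shows that \<open>p\<^sub>2 \<dots> p\<^sub>n\<close> already lies in \<open>I\<close>. The case \<open>n = 0\<close> is \<open>I = R\<close>.
\<close>

context cring
begin

lemma mem_comax_setI:
  assumes "r \<in> carrier R" "s \<in> carrier R" "a \<in> carrier R" "b \<in> carrier R"
    and "a \<otimes> r \<oplus> b \<otimes> s = \<one>"
  shows "s \<in> comax_set R r"
  unfolding mem_comax_set_iff[OF assms(1,2)] using assms(3-5) by (intro bexI)

lemma mem_comax_setE:
  assumes "s \<in> comax_set R r" "r \<in> carrier R"
  obtains a b where "s \<in> carrier R" "a \<in> carrier R" "b \<in> carrier R" "a \<otimes> r \<oplus> b \<otimes> s = \<one>"
proof -
  have s: "s \<in> carrier R" using assms(1) by (simp add: comax_set_def)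
  show thesis
    using assms(1) that[OF s] unfolding mem_comax_set_iff[OF assms(2) s] by (elim bexE)
qed

text \<open>
  A neighbourhood of a multiple \<open>t \<otimes> p\<close> is also one of \<open>p\<close>: in a relation
  \<open>a \<otimes> r \<oplus> b \<otimes> (t \<otimes> p) = \<one>\<close> the factor \<open>t\<close> can be absorbed into \<open>b\<close>.
\<close>
lemma cgenideal_subset_closure_of:
  assumes p: "p \<in> carrier R"
  shows "PIdl p \<subseteq> comax_topology R closure_of {p}"
proof
  fix s assume "s \<in> PIdl p"
  then obtain t where t: "t \<in> carrier R" "s = t \<otimes> p"
    by (auto simp: cgenideal_def)
  have "p \<in> U" if "openin (comax_topology R) U" "s \<in> U" for U
  proof -
    from that obtain r where r: "r \<in> carrier R" "s \<in> comax_set R r" "comax_set R r \<subseteq> U"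
      unfolding openin_comax_topology arbitrary_union_of_alt by blast
    from r(2,1) obtain a b where ab: "a \<in> carrier R" "b \<in> carrier R" "a \<otimes> r \<oplus> b \<otimes> s = \<one>"
      by (rule mem_comax_setE)
    then have "a \<otimes> r \<oplus> (b \<otimes> t) \<otimes> p = \<one>"
      using t p by (simp add: m_assoc)
    then have "p \<in> comax_set R r"
      using ab(1,2) t(1) p r(1) by (intro mem_comax_setI[of r p a "b \<otimes> t"]) simp_all
    then show "p \<in> U" using r(3) by (rule rev_subsetD)
  qed
  then show "s \<in> comax_topology R closure_of {p}"
    using t p by (auto simp: in_closure_of topspace_comax_topology)
qed

lemma closure_of_subset_comax_complement:
  assumes p: "p \<in> carrier R" and nonunit: "p \<notin> Units R"
  shows "comax_topology R closure_of {p} \<subseteq> carrier R - comax_set R p"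
proof -
  have "p \<notin> comax_set R p"
  proof
    assume "p \<in> comax_set R p"
    then obtain a b where ab: "a \<in> carrier R" "b \<in> carrier R" "a \<otimes> p \<oplus> b \<otimes> p = \<one>"
      using p by (rule mem_comax_setE)
    then have "p \<otimes> (a \<oplus> b) = \<one>"
      using p by (simp add: r_distr m_comm)
    then have "p divides \<one>"
      unfolding factor_def using ab(1,2) by (intro bexI[of _ "a \<oplus> b"]) auto
    then show False
      using nonunit divides_one[OF p] by blast
  qed
  moreover have "openin (comax_topology R) (comax_set R p)"
    unfolding openin_comax_topology using p by (intro arbitrary_union_of_inc) auto
  ultimately show ?thesis
    using closure_of_subset_topspace[of "comax_topology R" "{p}"]
    by (auto simp: in_closure_of topspace_comax_topology)
qed

text \<open>
  Since the complement of \<open>comax_set R p\<close> consists of the \<open>s\<close> for which \<open>p\<close> and \<open>s\<close> together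
  generate a proper ideal, maximality of \<open>PIdl p\<close> forces such \<open>s\<close> into \<open>PIdl p\<close>. Conversely, an
  ideal that contains \<open>p\<close> and some element comaximal with \<open>p\<close> contains \<open>\<one>\<close>. A unit \<open>p\<close> satisfies
  neither side.
\<close>
lemma maximalideal_cgenideal_iff:
  assumes p: "p \<in> carrier R"
  shows "maximalideal (PIdl p) R \<longleftrightarrow> PIdl p = carrier R - comax_set R p"
proof
  assume max: "maximalideal (PIdl p) R"
  show "PIdl p = carrier R - comax_set R p"
  proof (intro equalityI subsetI)
    fix s assume "s \<in> PIdl p"
    moreover have "p \<notin> Units R"
      using maximalideal.I_notcarr[OF max] ideal_eq_carrier_iff[OF p] by blast
    ultimately show "s \<in> carrier R - comax_set R p"
      using cgenideal_subset_closure_of[OF p] closure_of_subset_comax_complement[OF p] by blast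
  next
    fix s assume s: "s \<in> carrier R - comax_set R p"
    let ?J = "PIdl p <+>\<^bsub>R\<^esub> PIdl s"
    have J: "ideal ?J R"
      using p s by (intro add_ideals cgenideal_ideal) auto
    have "?J = Idl (PIdl p \<union> PIdl s)"
      using p s union_genideal[OF cgenideal_ideal cgenideal_ideal] by simp
    moreover have "PIdl p \<union> PIdl s \<subseteq> carrier R"
      using p s by (auto simp: cgenideal_def)
    ultimately have sub: "PIdl p \<subseteq> ?J" "PIdl s \<subseteq> ?J"
      using genideal_self by blast+
    have "?J \<noteq> carrier R"
      using p s by (simp add: comax_set_def cgenideal_eq_genideal)
    then have "?J = PIdl p"
      using maximalideal.I_maximal[OF max J sub(1)] ideal.Icarr[OF J] by blast
    then show "s \<in> PIdl p"
      using sub(2) cgenideal_self s by blast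
  qed
next
  assume eq: "PIdl p = carrier R - comax_set R p"
  show "maximalideal (PIdl p) R"
  proof (rule maximalidealI)
    show "ideal (PIdl p) R" using p by (rule cgenideal_ideal)
    have "\<zero> \<otimes> p \<oplus> \<one> \<otimes> \<one> = \<one>" using p by simp
    then have "\<one> \<in> comax_set R p"
      using p by (intro mem_comax_setI[of p \<one> \<zero> \<one>]) simp_all
    then show "carrier R \<noteq> PIdl p" using eq by blast
  next
    fix J assume J: "ideal J R" "PIdl p \<subseteq> J" "J \<subseteq> carrier R"
    interpret J: ideal J R by fact
    show "J = PIdl p \<or> J = carrier R"
    proof (cases "J \<subseteq> PIdl p")
      case False
      then obtain s where s: "s \<in> J" "s \<in> comax_set R p"
        using eq J(3) by blast
      from s(2) p obtain a b where ab: "a \<in> carrier R" "b \<in> carrier R" "a \<otimes> p \<oplus> b \<otimes> s = \<one>"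
        by (rule mem_comax_setE)
      have "p \<in> J" using J(2) cgenideal_self[OF p] by blast
      then have "a \<otimes> p \<oplus> b \<otimes> s \<in> J"
        using ab(1,2) s(1) by (simp add: J.I_l_closed)
      then have "\<one> \<in> J" using ab(3) by simp
      then show ?thesis using J.one_imp_carrier by blast
    qed (use J(2) in blast)
  qed
qed

text \<open>
  This is the inductive step that strips one irreducible factor \<open>p\<close> from an element of \<open>I\<close>.
  Either \<open>p\<close> divides all of \<open>I\<close> and can be cancelled from the whole ideal, or \<open>I\<close> and \<open>p\<close> are
  comaximal, so that \<open>p\<close> is invertible modulo \<open>I\<close> and can be cancelled from \<open>p \<otimes> a \<in> I\<close>.
\<close>
lemma principal_of_maximal_factor:
  assumes p: "p \<in> carrier R" and max: "maximalideal (PIdl p) R" and a: "a \<in> carrier R"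
    and IH: "\<And>J. \<lbrakk>ideal J R; a \<in> J\<rbrakk> \<Longrightarrow> \<exists>c\<in>carrier R. J = PIdl c"
    and I: "ideal I R" and pa: "p \<otimes> a \<in> I"
  shows "\<exists>c\<in>carrier R. I = PIdl c"
proof -
  interpret I: ideal I R by fact
  show ?thesis
  proof (cases "I \<subseteq> PIdl p")
    case True
    \<comment> \<open>Here \<open>J\<close> is the colon ideal of \<open>I\<close> by \<open>p\<close>, and \<open>I = p J\<close>.\<close>
    define J where "J = {x \<in> carrier R. p \<otimes> x \<in> I}"
    have "ideal J R"
    proof (rule idealI)
      show "subgroup J (add_monoid R)"
      proof (rule add.subgroupI)
        show "J \<noteq> {}" using p additive_subgroup.zero_closed[OF I.is_additive_subgroup] by (auto simp: J_def)
      qed (use p in \<open>auto simp: J_def r_distr r_minus\<close>)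
      fix x y assume "x \<in> J" and y: "y \<in> carrier R"
      then have x: "x \<in> carrier R" "p \<otimes> x \<in> I" by (auto simp: J_def)
      have "p \<otimes> (x \<otimes> y) \<in> I"
        using I.I_r_closed[OF x(2) y] p x(1) y by (simp add: m_assoc)
      then show "x \<otimes> y \<in> J" "y \<otimes> x \<in> J"
        using x(1) y by (simp_all add: J_def m_comm)
    qed (rule ring_axioms)
    moreover have "a \<in> J" using a pa by (simp add: J_def)
    ultimately obtain c where c: "c \<in> carrier R" "J = PIdl c"
      using IH by blast
    have "I = PIdl (p \<otimes> c)"
    proof
      have "c \<in> J" using c cgenideal_self by blast
      then show "PIdl (p \<otimes> c) \<subseteq> I"
        using cgenideal_minimal[OF I] by (simp add: J_def)
      show "I \<subseteq> PIdl (p \<otimes> c)"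
      proof
        fix y assume y: "y \<in> I"
        then obtain x where x: "x \<in> carrier R" "y = x \<otimes> p"
          using True by (auto simp: cgenideal_def)
        then have "x \<in> J" using y p by (simp add: J_def m_comm)
        then obtain z where z: "z \<in> carrier R" "x = z \<otimes> c"
          unfolding c(2) by (auto simp: cgenideal_def)
        have "y = z \<otimes> (p \<otimes> c)"
          using x z p c(1) by (simp add: m_ac)
        then show "y \<in> PIdl (p \<otimes> c)"
          using z(1) by (auto simp: cgenideal_def)
      qed
    qed
    then show ?thesis using p c(1) by blast
  next
    case False
    then obtain b where b: "b \<in> I" "b \<in> comax_set R p"
      using max p I.Icarr by (auto simp: maximalideal_cgenideal_iff)
    obtain x y where bc: "b \<in> carrier R"
      and xy: "x \<in> carrier R" "y \<in> carrier R" "x \<otimes> p \<oplus> y \<otimes> b = \<one>"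
      using b(2) p by (rule mem_comax_setE)
    have "a = (x \<otimes> p \<oplus> y \<otimes> b) \<otimes> a"
      using xy(3) a by simp
    also have "\<dots> = x \<otimes> (p \<otimes> a) \<oplus> (y \<otimes> a) \<otimes> b"
      using xy(1,2) a p bc by algebra
    also have "\<dots> \<in> I"
      using xy(1,2) a pa b(1) by (simp add: I.I_l_closed)
    finally show ?thesis using IH I by blast
  qed
qed

end

text \<open>
  Maximality of the ideals generated by irreducibles suffices because every nonzero ideal contains
  a product of irreducibles, whose factors \<open>principal_of_maximal_factor\<close> removes one by one.
\<close>
theorem (in factorial_domain) principal_domain_iff_irreducible_maximal:
  "principal_domain R \<longleftrightarrow>
    (\<forall>p\<in>carrier R. ring_irreducible p \<longrightarrow> maximalideal (PIdl p) R)"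
proof
  assume "principal_domain R"
  then show "\<forall>p\<in>carrier R. ring_irreducible p \<longrightarrow> maximalideal (PIdl p) R"
    by (intro ballI impI principal_domain.irreducible_imp_maximalideal)
next
  assume max: "\<forall>p\<in>carrier R. ring_irreducible p \<longrightarrow> maximalideal (PIdl p) R"
  have unit: "\<exists>c\<in>carrier R. I = PIdl c" if I: "ideal I R" and u: "u \<in> I" "u \<in> Units R" for I u
  proof -
    have uc: "u \<in> carrier R" using u(2) by (rule Units_closed)
    have "carrier R = PIdl u" using ideal_eq_carrier_iff[OF uc] u(2) by simp
    moreover have "PIdl u \<subseteq> I" using I u(1) by (rule cgenideal_minimal)
    moreover have "I \<subseteq> carrier R" using ideal.Icarr[OF I] by (rule subsetI)
    ultimately have "I = PIdl u" by (intro subset_antisym) simp_all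
    then show ?thesis using uc by (rule bexI)
  qed
  have product: "\<exists>c\<in>carrier R. I = PIdl c"
    if "set fs \<subseteq> carrier (mult_of R)" "\<forall>f\<in>set fs. irreducible (mult_of R) f"
      "ideal I R" "foldr (\<otimes>) fs \<one> \<in> I" for fs I
    using that
  proof (induction fs arbitrary: I)
    case Nil
    then show ?case using unit[of I \<one>] Units_one_closed by simp
  next
    case (Cons p fs)
    have p: "p \<in> carrier R - {\<zero>}" "irreducible (mult_of R) p"
      using Cons.prems by auto
    have fs: "set fs \<subseteq> carrier (mult_of R)" "\<forall>f\<in>set fs. irreducible (mult_of R) f"
      using Cons.prems by auto
    have "ring_irreducible p"
      using p by (rule ring_irreducibleI')
    then have maxp: "maximalideal (PIdl p) R"
      using max p(1) by simp
    have prod: "foldr (\<otimes>) fs \<one> \<in> carrier R"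
      using fs(1) by (intro multlist_closed) auto
    show ?case
    proof (rule principal_of_maximal_factor[OF _ maxp prod Cons.IH[OF fs] Cons.prems(3)])
      show "p \<in> carrier R" using p(1) by simp
      show "p \<otimes> foldr (\<otimes>) fs \<one> \<in> I"
        using Cons.prems(4) by simp
    qed
  qed
  show "principal_domain R"
  proof
    fix I assume I: "ideal I R"
    interpret I: ideal I R by fact
    show "\<exists>a\<in>carrier R. I = PIdl a"
    proof (cases "I = {\<zero>}")
      case True
      moreover have "PIdl \<zero> = {\<zero>}"
        by (auto simp: cgenideal_def intro!: exI[of _ "\<zero>"])
      ultimately show ?thesis using zero_closed by (intro bexI[of _ "\<zero>"]) simp_all
    next
      case False
      then obtain a where a: "a \<in> I" "a \<noteq> \<zero>"
        using additive_subgroup.zero_closed[OF I.is_additive_subgroup] by blast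
      then have ac: "a \<in> carrier (mult_of R)" using I.Icarr by simp
      show ?thesis
      proof (cases "a \<in> Units R")
        case True
        with I a(1) show ?thesis by (rule unit)
      next
        case False
        then obtain fs where fs: "set fs \<subseteq> carrier (mult_of R)" "factors (mult_of R) fs a"
          using factors_exist[OF ac] by (metis Units_mult_eq_Units)
        show ?thesis
        proof (rule product[OF fs(1) _ I])
          show "\<forall>f\<in>set fs. irreducible (mult_of R) f" "foldr (\<otimes>) fs \<one> \<in> I"
            using fs(2) a(1) by (simp_all add: factors_def)
        qed
      qed
    qed
  qed
qed

theorem corollary3p17:
  fixes R :: "('a, 'b) ring_scheme" (structure)
  assumes "factorial_domain R" and "\<not> field R"
  shows "principal_domain R \<longleftrightarrow>
    (\<forall>p\<in>carrier R. ring_irreducible p \<longrightarrow>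
       Idl {p} = comax_topology R closure_of {p} \<and>
       comax_topology R closure_of {p} = carrier R - comax_set R p)"
proof -
  interpret factorial_domain R by fact
  have "maximalideal (PIdl p) R \<longleftrightarrow>
      Idl {p} = comax_topology R closure_of {p} \<and>
      comax_topology R closure_of {p} = carrier R - comax_set R p"
    if p: "p \<in> carrier R" "ring_irreducible p" for p
  proof -
    have "PIdl p \<subseteq> comax_topology R closure_of {p}"
      using p(1) by (rule cgenideal_subset_closure_of)
    moreover have "comax_topology R closure_of {p} \<subseteq> carrier R - comax_set R p"
      using p(1) ring_irreducibleE(4)[OF p] by (rule closure_of_subset_comax_complement)
    ultimately show ?thesis
      unfolding maximalideal_cgenideal_iff[OF p(1)] cgenideal_eq_genideal[OF p(1), symmetric]
      by (metis subset_antisym)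
  qed
  then show ?thesis
    by (simp add: principal_domain_iff_irreducible_maximal)
qed

end
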